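(* Let $G$ be a graph with a transitive decomposition $\{H_1,\dots,H_t\}$, let $c$ be a positive real number and let $\Sigma$ be an arbitrary surface. Then $\mathrm{cr}_{\Sigma}(G)\geq\lceil ct\rceil$ if and only if $\max\{l^D_c(H_1),\dots,l^D_c(H_t)\}\leq t$ for every good drawing $D$ of $G$ in $\Sigma$.
   Context: A drawing of a graph in a surface is good if no edge crosses itself, adjacent edges do not cross, no two edges cross more than once, and no three edges cross at a common point; $\mathrm{cr}_\Sigma(G)$ is the minimum number of crossings over all good drawings of $G$ in $\Sigma$. A decomposition of $G$ is a list of edge-disjoint subgraphs of $G$ such that every edge of $G$ lies in one of them. A decomposition $\{H_1,\dots,H_t\}$ of $G$ is transitive if for every pair $1\le i,j\le t$ there is an automorphism $\theta_{i,j}$ of $G$ such that $uv\in E(H_{i+\ell})$ iff $\theta_{i,j}(u)\theta_{i,j}(v)\in E(H_{j+\ell})$ for all $0\le \ell<t$ (subscripts modulo $t$). For edge-disjoint subgraphs $A,B$ of $G$ and a good drawing $D$, $\mathrm{cr}_D(A,B)$ is the number of crossings in $D$ between an edge of $A$ and an edge of $B$, and $\mathrm{cr}_D(A)$ is the number of crossings among edges of $A$. For a subgraph $H$ of $G$, $f_D(H)=\mathrm{cr}_D(H)+\mathrm{cr}_D(H,G\setminus E(H))/2$. For $j-i<t$, $H_{i,j}$ denotes $H_i\cup\dots\cup H_j$ with subscripts modulo $t$. For $c>0$ and $1\le i\le t$, $l^D_c(H_i)$ is the smallest positive integer $l\le t$ with $f_D(H_{i,i-1+l})\geq lc$ if such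 an integer exists, and $l^D_c(H_i)=t+1$ otherwise. *)

theory Defs
  imports "HOL-Analysis.Analysis" "HOL-Library.Extended_Nat"
begin

section \<open>Graphs and transitive decompositions\<close>

record 'v ugraph =
  verts :: "'v set"
  edges :: "'v set set"

definition simple_graph :: "'v ugraph \<Rightarrow> bool" where
  "simple_graph G \<longleftrightarrow> finite (verts G) \<and>
     (\<forall>e\<in>edges G. \<exists>u\<in>verts G. \<exists>v\<in>verts G. u \<noteq> v \<and> e = {u, v})"

definition subgraph :: "'v ugraph \<Rightarrow> 'v ugraph \<Rightarrow> bool" where
  "subgraph H G \<longleftrightarrow> simple_graph H \<and> verts H \<subseteq> verts G \<and> edges H \<subseteq> edges G"

definition delete_edges :: "'v ugraph \<Rightarrow> 'v set set \<Rightarrow> 'v ugraph" where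
  "delete_edges G F = \<lparr>verts = verts G, edges = edges G - F\<rparr>"

definition graph_automorphism :: "'v ugraph \<Rightarrow> ('v \<Rightarrow> 'v) \<Rightarrow> bool" where
  "graph_automorphism G \<theta> \<longleftrightarrow> bij_betw \<theta> (verts G) (verts G) \<and>
     (\<forall>u\<in>verts G. \<forall>v\<in>verts G. {u, v} \<in> edges G \<longleftrightarrow> {\<theta> u, \<theta> v} \<in> edges G)"

text \<open>The representative of \<open>k\<close> modulo \<open>t\<close> in \<open>{1..t}\<close>.\<close>

definition cyc :: "nat \<Rightarrow> nat \<Rightarrow> nat" where
  "cyc t k = (if k mod t = 0 then t else k mod t)"

text \<open>A decomposition into \<open>t\<close> subgraphs is the family \<open>H 1, \<dots>, H t\<close>; the values of \<open>H\<close>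
  outside \<open>{1..t}\<close> are irrelevant.\<close>

definition decomposition :: "'v ugraph \<Rightarrow> nat \<Rightarrow> (nat \<Rightarrow> 'v ugraph) \<Rightarrow> bool" where
  "decomposition G t H \<longleftrightarrow>
     (\<forall>i\<in>{1..t}. subgraph (H i) G) \<and>
     (\<forall>i\<in>{1..t}. \<forall>j\<in>{1..t}. i \<noteq> j \<longrightarrow> edges (H i) \<inter> edges (H j) = {}) \<and>
     (\<forall>e\<in>edges G. \<exists>i\<in>{1..t}. e \<in> edges (H i))"

definition transitive_decomposition :: "'v ugraph \<Rightarrow> nat \<Rightarrow> (nat \<Rightarrow> 'v ugraph) \<Rightarrow> bool" where
  "transitive_decomposition G t H \<longleftrightarrow> decomposition G t H \<and>
     (\<forall>i\<in>{1..t}. \<forall>j\<in>{1..t}. \<exists>\<theta>. graph_automorphism G \<theta> \<and>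
        (\<forall>l<t. \<forall>u\<in>verts G. \<forall>v\<in>verts G.
           {u, v} \<in> edges (H (cyc t (i + l))) \<longleftrightarrow> {\<theta> u, \<theta> v} \<in> edges (H (cyc t (j + l)))))"

definition segment_union :: "nat \<Rightarrow> (nat \<Rightarrow> 'v ugraph) \<Rightarrow> nat \<Rightarrow> nat \<Rightarrow> 'v ugraph" where
  "segment_union t H i j =
     \<lparr>verts = (\<Union>k\<in>{i..j}. verts (H (cyc t k))), edges = (\<Union>k\<in>{i..j}. edges (H (cyc t k)))\<rparr>"

section \<open>Surfaces and drawings\<close>

definition surface :: "'a topology \<Rightarrow> bool" where
  "surface X \<longleftrightarrow> topspace X \<noteq> {} \<and> connected_space X \<and> Hausdorff_space X \<and> second_countable X \<and>
     (\<forall>x\<in>topspace X. \<exists>U. openin X U \<and> x \<in> U \<and>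
        subtopology X U homeomorphic_space (euclidean :: (real^2) topology))"

text \<open>The curves \<open>g\<close> at parameter \<open>s\<close> and \<open>g'\<close> at parameter \<open>s'\<close> pass through the same point,
  and some chart around it carries the two local branches to the two coordinate axes. This is
  the topological form of a transversal crossing; it excludes tangential contact.\<close>

definition transversal_at ::
  "'a topology \<Rightarrow> (real \<Rightarrow> 'a) \<Rightarrow> real \<Rightarrow> (real \<Rightarrow> 'a) \<Rightarrow> real \<Rightarrow> bool" where
  "transversal_at X g s g' s' \<longleftrightarrow> g s = g' s' \<and>
     (\<exists>U (h :: 'a \<Rightarrow> real^2) a b a' b'.
        openin X U \<and> homeomorphic_map (subtopology X U) euclidean h \<and>
        s \<in> {a<..<b} \<and> {a<..<b} \<subseteq> {0..1} \<and> g ` {a<..<b} \<subseteq> U \<and>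
        s' \<in> {a'<..<b'} \<and> {a'<..<b'} \<subseteq> {0..1} \<and> g' ` {a'<..<b'} \<subseteq> U \<and>
        bij_betw (h \<circ> g) {a<..<b} {x. x $ 2 = 0} \<and>
        bij_betw (h \<circ> g') {a'<..<b'} {x. x $ 1 = 0})"

record ('v, 'a) drawing =
  vpoint :: "'v \<Rightarrow> 'a"
  ecurve :: "'v set \<Rightarrow> real \<Rightarrow> 'a"

text \<open>Vertices are distinct points, an edge is a curve between its ends whose interior avoids
  all vertices, and whenever two edge interiors (or two different parts of one edge interior)
  meet, they cross there.\<close>

definition is_drawing :: "'a topology \<Rightarrow> 'v ugraph \<Rightarrow> ('v, 'a) drawing \<Rightarrow> bool" where
  "is_drawing X G D \<longleftrightarrow>
     inj_on (vpoint D) (verts G) \<and> vpoint D ` verts G \<subseteq> topspace X \<and>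
     (\<forall>e\<in>edges G. pathin X (ecurve D e) \<and> {ecurve D e 0, ecurve D e 1} = vpoint D ` e \<and>
        ecurve D e ` {0<..<1} \<inter> vpoint D ` verts G = {}) \<and>
     (\<forall>e\<in>edges G. \<forall>f\<in>edges G. \<forall>s\<in>{0<..<1}. \<forall>s'\<in>{0<..<1}.
        (e, s) \<noteq> (f, s') \<and> ecurve D e s = ecurve D f s' \<longrightarrow>
        transversal_at X (ecurve D e) s (ecurve D f) s')"

text \<open>Edges \<open>e\<close> and \<open>f\<close> cross at \<open>p\<close> (for \<open>e = f\<close>: a self-crossing). Transversality need not be
  repeated here, as it is part of \<^const>\<open>is_drawing\<close>.\<close>

definition cross_at :: "('v, 'a) drawing \<Rightarrow> 'v set \<Rightarrow> 'v set \<Rightarrow> 'a \<Rightarrow> bool" where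
  "cross_at D e f p \<longleftrightarrow> (\<exists>s\<in>{0<..<1}. \<exists>s'\<in>{0<..<1}.
     (e, s) \<noteq> (f, s') \<and> ecurve D e s = p \<and> ecurve D f s' = p)"

definition good_drawing :: "'a topology \<Rightarrow> 'v ugraph \<Rightarrow> ('v, 'a) drawing \<Rightarrow> bool" where
  "good_drawing X G D \<longleftrightarrow> is_drawing X G D \<and>
     (\<forall>e\<in>edges G. \<not> (\<exists>p. cross_at D e e p)) \<and>
     (\<forall>e\<in>edges G. \<forall>f\<in>edges G. e \<noteq> f \<and> e \<inter> f \<noteq> {} \<longrightarrow> \<not> (\<exists>p. cross_at D e f p)) \<and>
     (\<forall>e\<in>edges G. \<forall>f\<in>edges G. e \<noteq> f \<longrightarrow>
        (\<forall>p q. cross_at D e f p \<and> cross_at D e f q \<longrightarrow> p = q)) \<and>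
     (\<forall>e\<in>edges G. \<forall>f\<in>edges G. \<forall>g\<in>edges G. e \<noteq> f \<and> f \<noteq> g \<and> e \<noteq> g \<longrightarrow>
        \<not> (\<exists>p. cross_at D e f p \<and> cross_at D f g p \<and> cross_at D e g p))"

section \<open>Counting crossings\<close>

text \<open>In a good drawing a crossing point determines the two edges crossing there, so crossings
  are counted as points.\<close>

definition cr_between :: "('v, 'a) drawing \<Rightarrow> 'v ugraph \<Rightarrow> 'v ugraph \<Rightarrow> nat" where
  "cr_between D A B = card {p. \<exists>e\<in>edges A. \<exists>f\<in>edges B. cross_at D e f p}"

definition cr_within :: "('v, 'a) drawing \<Rightarrow> 'v ugraph \<Rightarrow> nat" where
  "cr_within D A = card {p. \<exists>e\<in>edges A. \<exists>f\<in>edges A. cross_at D e f p}"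

text \<open>An infimum of naturals in \<^typ>\<open>enat\<close> is the minimum whenever a good drawing exists.\<close>

definition crossing_number :: "'a topology \<Rightarrow> 'v ugraph \<Rightarrow> enat" where
  "crossing_number X G = (INF D\<in>{D :: ('v, 'a) drawing. good_drawing X G D}. enat (cr_within D G))"

definition f_val :: "'v ugraph \<Rightarrow> ('v, 'a) drawing \<Rightarrow> 'v ugraph \<Rightarrow> real" where
  "f_val G D H = real (cr_within D H) + real (cr_between D H (delete_edges G (edges H))) / 2"

definition l_val ::
  "'v ugraph \<Rightarrow> nat \<Rightarrow> (nat \<Rightarrow> 'v ugraph) \<Rightarrow> real \<Rightarrow> ('v, 'a) drawing \<Rightarrow> nat \<Rightarrow> nat" where
  "l_val G t H c D i =
     (let P = (\<lambda>l. 1 \<le> l \<and> l \<le> t \<and> f_val G D (segment_union t H i (i - 1 + l)) \<ge> real l * c)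
      in if \<exists>l. P l then (LEAST l. P l) else t + 1)"

end

theory Submission
  imports Defs
begin

text \<open>In a good drawing every crossing lies on exactly two edges, so \<open>f\<^sub>D(A)\<close> is half the number
  of incidences between crossings and edges of \<open>A\<close>. Hence \<open>f\<^sub>D\<close> is additive over edge-disjoint
  subgraphs, and the theorem becomes a statement about the cyclic sequence \<open>a\<^sub>k = f\<^sub>D(H\<^sub>k)\<close>, whose
  total is the number of crossings of \<open>D\<close>. If from every position some block has average at least
  \<open>c\<close>, then consecutive blocks can be chained until two of their starting points agree modulo
  \<open>t\<close>; these blocks cover a whole number of periods, so the average over one period is at least
  \<open>c\<close>. Conversely, one period is itself a block of length \<open>t\<close>.\<close>

lemma inj_on_mod_atLeastLessThan:
  fixes t :: nat
  assumes "l \<le> t"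
  shows "inj_on (\<lambda>k. k mod t) {i..<i + l}"
proof (rule linorder_inj_onI)
  fix j k
  assume "j < k" "j \<in> {i..<i + l}" "k \<in> {i..<i + l}"
  then have "0 < k - j" "k - j < t"
    using assms by auto
  then have "\<not> t dvd k - j"
    by (rule nat_dvd_not_less)
  then show "j mod t \<noteq> k mod t"
    using \<open>j < k\<close> by (metis less_imp_le mod_eq_dvd_iff_nat)
qed auto

lemma bij_betw_mod_period: "bij_betw (\<lambda>k. k mod t) {i..<i + t} {..<t}"
  for t :: nat
proof (rule bij_betw_imageI)
  show inj: "inj_on (\<lambda>k. k mod t) {i..<i + t}"
    by (rule inj_on_mod_atLeastLessThan) simp
  show "(\<lambda>k. k mod t) ` {i..<i + t} = {..<t}"
    using card_image[OF inj] by (intro card_subset_eq) auto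
qed

lemma sum_mod_period:
  fixes a :: "nat \<Rightarrow> 'a::comm_monoid_add"
  shows "(\<Sum>k = i..<i + t. a (k mod t)) = sum a {..<t}"
  by (rule sum.reindex_bij_betw[OF bij_betw_mod_period])

lemma sum_mod_periods:
  fixes a :: "nat \<Rightarrow> 'a::semiring_1"
  shows "(\<Sum>k = i..<i + q * t. a (k mod t)) = of_nat q * sum a {..<t}"
proof (induction q)
  case (Suc q)
  have "(\<Sum>k = i..<i + Suc q * t. a (k mod t))
      = (\<Sum>k = i..<i + q * t. a (k mod t)) + (\<Sum>k = i + q * t..<i + q * t + t. a (k mod t))"
    by (simp add: sum.atLeastLessThan_concat add_ac)
  also have "\<dots> = of_nat q * sum a {..<t} + sum a {..<t}"
    by (simp only: Suc.IH sum_mod_period)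
  finally show ?case
    by (simp add: distrib_right add.commute)
qed simp

lemma sum_mod_block_start_mod:
  fixes a :: "nat \<Rightarrow> 'a::comm_monoid_add"
  shows "(\<Sum>k = i mod t..<i mod t + l. a (k mod t)) = (\<Sum>k = i..<i + l. a (k mod t))"
  using sum.shift_bounds_nat_ivl[of "\<lambda>k. a (k mod t)" 0 "i mod t" l]
    sum.shift_bounds_nat_ivl[of "\<lambda>k. a (k mod t)" 0 i l]
  by (simp add: mod_add_right_eq add.commute)

lemma sum_consecutive_blocks:
  fixes a :: "nat \<Rightarrow> 'a::comm_monoid_add"
  assumes "mono pos" "m \<le> n"
  shows "sum a {pos m..<pos n} = (\<Sum>j = m..<n. sum a {pos j..<pos (Suc j)})"
  using assms(2)
proof (induction n rule: dec_induct)
  case (step n)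
  have "pos m \<le> pos n" "pos n \<le> pos (Suc n)"
    using assms(1) step.hyps by (simp_all add: monoD)
  then have "sum a {pos m..<pos (Suc n)} = sum a {pos m..<pos n} + sum a {pos n..<pos (Suc n)}"
    by (simp add: sum.atLeastLessThan_concat)
  then show ?case
    using step by simp
qed simp

lemma ex_less_mod_eq:
  fixes f :: "nat \<Rightarrow> nat"
  assumes "0 < t"
  obtains m n where "m < n" "f m mod t = f n mod t"
proof -
  have "card ((\<lambda>n. f n mod t) ` {..t}) \<le> card {..<t}"
    using assms by (intro card_mono) auto
  then have "\<not> inj_on (\<lambda>n. f n mod t) {..t}"
    by (intro pigeonhole) simp
  then show ?thesis
    using that unfolding inj_on_def by (metis linorder_neqE_nat)
qed

lemma sum_nonneg_if_cyclic_blocks_nonneg: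
  fixes a :: "nat \<Rightarrow> 'a::linordered_idom"
  assumes "0 < t"
    and blocks: "\<And>i. i < t \<Longrightarrow> \<exists>l>0. 0 \<le> (\<Sum>k = i..<i + l. a (k mod t))"
  shows "0 \<le> sum a {..<t}"
proof -
  have "\<exists>j>i. 0 \<le> (\<Sum>k = i..<j. a (k mod t))" for i
  proof -
    obtain l where "0 < l" "0 \<le> (\<Sum>k = i mod t..<i mod t + l. a (k mod t))"
      using blocks[of "i mod t"] \<open>0 < t\<close> by auto
    then show ?thesis
      by (intro exI[of _ "i + l"]) (simp add: sum_mod_block_start_mod)
  qed
  then obtain block_end where block_end:
    "\<And>i. i < block_end i" "\<And>i. 0 \<le> (\<Sum>k = i..<block_end i. a (k mod t))"
    by metis
  define pos where "pos n = (block_end ^^ n) 0" for n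
  have pos_Suc: "pos (Suc n) = block_end (pos n)" for n
    by (simp add: pos_def)
  have "strict_mono pos"
    by (simp add: strict_mono_Suc_iff pos_Suc block_end(1))
  obtain m n where "m < n" and mod_eq: "pos m mod t = pos n mod t"
    using ex_less_mod_eq[OF \<open>0 < t\<close>] .
  have chain_nonneg: "0 \<le> (\<Sum>k = pos m..<pos n. a (k mod t))"
    using \<open>strict_mono pos\<close> \<open>m < n\<close> block_end(2)
    by (simp add: sum_consecutive_blocks strict_mono_mono sum_nonneg pos_Suc)
  have "pos m < pos n"
    using \<open>strict_mono pos\<close> \<open>m < n\<close> by (simp add: strict_mono_less)
  then have "t dvd pos n - pos m"
    using mod_eq by (metis less_imp_le mod_eq_dvd_iff_nat)
  then obtain q where "pos n - pos m = t * q" ..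
  then have pos_n_eq: "pos n = pos m + q * t"
    using \<open>pos m < pos n\<close> by (simp add: mult.commute)
  have "0 \<le> of_nat q * sum a {..<t}"
    using chain_nonneg by (simp add: pos_n_eq sum_mod_periods)
  moreover have "0 < q"
    using pos_n_eq \<open>pos m < pos n\<close> by (intro gr0I) simp
  ultimately show ?thesis
    by (simp add: zero_le_mult_iff)
qed

lemma cyclic_sum_ge_iff_blocks_ge:
  fixes a :: "nat \<Rightarrow> 'a::linordered_idom"
  assumes "0 < t"
  shows "of_nat t * c \<le> sum a {..<t} \<longleftrightarrow>
    (\<forall>i<t. \<exists>l\<in>{1..t}. of_nat l * c \<le> (\<Sum>k = i..<i + l. a (k mod t)))"
proof
  assume "of_nat t * c \<le> sum a {..<t}"
  then show "\<forall>i<t. \<exists>l\<in>{1..t}. of_nat l * c \<le> (\<Sum>k = i..<i + l. a (k mod t))"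
    using assms by (intro allI impI bexI[of _ t]) (simp_all add: sum_mod_period)
next
  assume blocks: "\<forall>i<t. \<exists>l\<in>{1..t}. of_nat l * c \<le> (\<Sum>k = i..<i + l. a (k mod t))"
  have "0 \<le> (\<Sum>k<t. a k - c)"
  proof (rule sum_nonneg_if_cyclic_blocks_nonneg[OF assms])
    fix i
    assume "i < t"
    then obtain l where "l \<in> {1..t}" "of_nat l * c \<le> (\<Sum>k = i..<i + l. a (k mod t))"
      using blocks by blast
    then show "\<exists>l>0. 0 \<le> (\<Sum>k = i..<i + l. a (k mod t) - c)"
      by (intro exI[of _ l]) (simp add: sum_subtractf)
  qed
  then show "of_nat t * c \<le> sum a {..<t}"
    by (simp add: sum_subtractf)
qed

lemma cyc_Suc: "0 < t \<Longrightarrow> cyc t (Suc k) = Suc (k mod t)"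
  by (simp add: cyc_def mod_Suc)

lemma simple_graph_finite_edges:
  assumes "simple_graph G"
  shows "finite (edges G)"
proof (rule finite_subset)
  show "edges G \<subseteq> Pow (verts G)"
    using assms by (auto simp: simple_graph_def)
  show "finite (Pow (verts G))"
    using assms by (simp add: simple_graph_def)
qed

lemma decomposition_UN_edges:
  assumes "decomposition G t H"
  shows "(\<Union>k<t. edges (H (Suc k))) = edges G"
proof -
  have "(\<Union>k<t. edges (H (Suc k))) = (\<Union>i\<in>Suc ` {..<t}. edges (H i))"
    by simp
  also have "\<dots> = edges G"
    using assms unfolding image_Suc_lessThan
    by (fastforce simp: decomposition_def subgraph_def)
  finally show ?thesis .
qed

lemma decomposition_disjoint_family:
  assumes "decomposition G t H"
  shows "disjoint_family_on (\<lambda>k. edges (H (Suc k))) {..<t}"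
  using assms by (simp add: decomposition_def disjoint_family_on_def)

lemma edges_segment_union:
  assumes "0 < t"
  shows "edges (segment_union t H (Suc i) (i + l))
    = (\<Union>r\<in>(\<lambda>k. k mod t) ` {i..<i + l}. edges (H (Suc r)))"
proof -
  have "edges (segment_union t H (Suc i) (i + l)) = (\<Union>k\<in>Suc ` {i..<i + l}. edges (H (cyc t k)))"
    by (simp only: segment_union_def image_Suc_atLeastLessThan atLeastLessThanSuc_atLeastAtMost
        ugraph.simps)
  also have "\<dots> = (\<Union>r\<in>(\<lambda>k. k mod t) ` {i..<i + l}. edges (H (Suc r)))"
    using assms by (simp only: image_image cyc_Suc)
  finally show ?thesis .
qed

lemma l_val_le_iff:
  "l_val G t H c D i \<le> t \<longleftrightarrow>
    (\<exists>l\<in>{1..t}. real l * c \<le> f_val G D (segment_union t H i (i - 1 + l)))"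
proof -
  let ?long_enough =
    "\<lambda>l. 1 \<le> l \<and> l \<le> t \<and> real l * c \<le> f_val G D (segment_union t H i (i - 1 + l))"
  have "(LEAST l. ?long_enough l) \<le> t" if "\<exists>l. ?long_enough l"
    using LeastI_ex[OF that] by blast
  then show ?thesis
    by (auto simp: l_val_def Let_def)
qed

definition edges_through :: "('v, 'a) drawing \<Rightarrow> 'v ugraph \<Rightarrow> 'a \<Rightarrow> 'v set set" where
  "edges_through D A p = {e \<in> edges A. p \<in> ecurve D e ` {0<..<1}}"

definition crossing_points :: "('v, 'a) drawing \<Rightarrow> 'v ugraph \<Rightarrow> 'v ugraph \<Rightarrow> 'a set" where
  "crossing_points D A B = {p. \<exists>e\<in>edges A. \<exists>f\<in>edges B. cross_at D e f p}"

lemma cr_within_eq_card: "cr_within D A = card (crossing_points D A A)"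
  by (simp add: cr_within_def crossing_points_def)

lemma cr_between_eq_card: "cr_between D A B = card (crossing_points D A B)"
  by (simp add: cr_between_def crossing_points_def)

lemma f_val_whole_graph: "f_val G D G = real (cr_within D G)"
  by (simp add: f_val_def cr_between_def delete_edges_def)

lemma edges_through_delete_edges:
  "edges_through D (delete_edges G (edges A)) p = edges_through D G p - edges_through D A p"
  by (auto simp: edges_through_def delete_edges_def)

lemma edges_through_mono: "edges A \<subseteq> edges B \<Longrightarrow> edges_through D A p \<subseteq> edges_through D B p"
  by (auto simp: edges_through_def)

lemma card_edges_through_UN_disjoint:
  assumes "finite I" "\<And>i. i \<in> I \<Longrightarrow> finite (edges (B i))"
    and "disjoint_family_on (\<lambda>i. edges (B i)) I"
    and "edges A = (\<Union>i\<in>I. edges (B i))"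
  shows "card (edges_through D A p) = (\<Sum>i\<in>I. card (edges_through D (B i) p))"
proof -
  have "edges_through D A p = (\<Union>i\<in>I. edges_through D (B i) p)"
    using assms(4) by (auto simp: edges_through_def)
  moreover have "disjoint_family_on (\<lambda>i. edges_through D (B i) p) I"
    using assms(3) by (auto simp: disjoint_family_on_def edges_through_def)
  ultimately show ?thesis
    using assms(1,2) by (simp add: card_UN_disjoint' edges_through_def)
qed

lemma cross_at_distinct_iff:
  assumes "e \<noteq> f"
  shows "cross_at D e f p \<longleftrightarrow> p \<in> ecurve D e ` {0<..<1} \<and> p \<in> ecurve D f ` {0<..<1}"
  using assms by (auto simp: cross_at_def intro: image_eqI[OF sym])

locale finite_good_drawing =
  fixes X :: "'a topology" and G :: "'v ugraph" and D :: "('v, 'a) drawing"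
  assumes good_drawing: "good_drawing X G D"
    and finite_edges: "finite (edges G)"
begin

lemma no_self_crossing: "e \<in> edges G \<Longrightarrow> \<not> cross_at D e e p"
  using good_drawing by (simp add: good_drawing_def)

lemma crossing_point_unique:
  assumes "e \<in> edges G" "f \<in> edges G" "cross_at D e f p" "cross_at D e f q"
  shows "p = q"
proof -
  have "e \<noteq> f"
    using assms no_self_crossing by blast
  then show ?thesis
    using good_drawing assms unfolding good_drawing_def by blast
qed

lemma mem_crossing_points_iff:
  assumes "edges A \<subseteq> edges G"
  shows "p \<in> crossing_points D A B \<longleftrightarrow>
    (\<exists>e\<in>edges_through D A p. \<exists>f\<in>edges_through D B p. e \<noteq> f)"
proof -
  have "cross_at D e f p \<longleftrightarrow> e \<noteq> f \<and> e \<in> edges_through D A p \<and> f \<in> edges_through D B p"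
    if "e \<in> edges A" "f \<in> edges B" for e f
    using that assms no_self_crossing[of e p]
    by (cases "e = f") (auto simp: cross_at_distinct_iff edges_through_def)
  moreover have "edges_through D A p \<subseteq> edges A" "edges_through D B p \<subseteq> edges B"
    by (auto simp: edges_through_def)
  ultimately show ?thesis
    unfolding crossing_points_def mem_Collect_eq by (meson subsetD)
qed

lemma finite_edges_through: "edges A \<subseteq> edges G \<Longrightarrow> finite (edges_through D A p)"
  using finite_subset[OF _ finite_edges] by (simp add: edges_through_def)

lemma finite_crossing_points: "finite (crossing_points D G G)"
proof -
  have "finite {p. cross_at D e f p}" if "e \<in> edges G" "f \<in> edges G" for e f
  proof (cases "\<exists>p. cross_at D e f p")
    case True
    then obtain p where "cross_at D e f p"
      by blast
    then have "{q. cross_at D e f q} = {p}"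
      using crossing_point_unique that by blast
    then show ?thesis
      by simp
  qed simp
  moreover have "crossing_points D G G = (\<Union>e\<in>edges G. \<Union>f\<in>edges G. {p. cross_at D e f p})"
    by (auto simp: crossing_points_def)
  ultimately show ?thesis
    using finite_edges by simp
qed

lemma no_triple_crossing:
  assumes "{e, f, g} \<subseteq> edges_through D G p" "e \<noteq> f" "f \<noteq> g" "e \<noteq> g"
  shows False
proof -
  have "cross_at D e f p" "cross_at D f g p" "cross_at D e g p"
    using assms by (simp_all add: cross_at_distinct_iff edges_through_def)
  moreover have "e \<in> edges G" "f \<in> edges G" "g \<in> edges G"
    using assms(1) by (simp_all add: edges_through_def)
  ultimately show False
    using good_drawing assms(2-4) unfolding good_drawing_def by metis
qed

lemma card_edges_through_crossing_point:
  assumes "p \<in> crossing_points D G G"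
  shows "card (edges_through D G p) = 2"
proof -
  obtain e f where "e \<noteq> f" "{e, f} \<subseteq> edges_through D G p"
    using assms by (auto simp: mem_crossing_points_iff)
  then have "edges_through D G p = {e, f}"
    using no_triple_crossing[of e f _ p] by blast
  then show ?thesis
    using \<open>e \<noteq> f\<close> by simp
qed

lemma card_edges_through_crossing_point_le:
  assumes "p \<in> crossing_points D G G" "edges A \<subseteq> edges G"
  shows "card (edges_through D A p) \<le> 2"
proof -
  have "card (edges_through D A p) \<le> card (edges_through D G p)"
    by (rule card_mono[OF finite_edges_through[OF order_refl] edges_through_mono[OF assms(2)]])
  then show ?thesis
    by (simp only: card_edges_through_crossing_point[OF assms(1)])
qed

lemma crossing_points_within:
  assumes "edges A \<subseteq> edges G"
  shows "crossing_points D A A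
    = {p \<in> crossing_points D G G. card (edges_through D A p) = 2}"
proof -
  have "crossing_points D A A \<subseteq> crossing_points D G G"
    using assms by (auto simp: crossing_points_def)
  moreover have "p \<in> crossing_points D A A \<longleftrightarrow> card (edges_through D A p) = 2"
    if "p \<in> crossing_points D G G" for p
  proof -
    have "p \<in> crossing_points D A A \<longleftrightarrow> \<not> card (edges_through D A p) \<le> Suc 0"
      using assms by (simp add: mem_crossing_points_iff card_le_Suc0_iff_eq finite_edges_through)
    moreover have "card (edges_through D A p) \<le> 2"
      using that assms by (rule card_edges_through_crossing_point_le)
    ultimately show ?thesis
      by linarith
  qed
  ultimately show ?thesis
    by blast
qed

lemma crossing_points_between:
  assumes "edges A \<subseteq> edges G"
  shows "crossing_points D A (delete_edges G (edges A))
    = {p \<in> crossing_points D G G. card (edges_through D A p) = 1}"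
proof -
  have "crossing_points D A (delete_edges G (edges A)) \<subseteq> crossing_points D G G"
    using assms by (auto simp: crossing_points_def delete_edges_def)
  moreover have "p \<in> crossing_points D A (delete_edges G (edges A)) \<longleftrightarrow>
      card (edges_through D A p) = 1"
    if "p \<in> crossing_points D G G" for p
  proof -
    let ?inside = "edges_through D A p" and ?outside = "edges_through D G p - edges_through D A p"
    have "p \<in> crossing_points D A (delete_edges G (edges A)) \<longleftrightarrow> ?inside \<noteq> {} \<and> ?outside \<noteq> {}"
      unfolding mem_crossing_points_iff[OF assms] edges_through_delete_edges
      by (metis DiffD2 ex_in_conv)
    also have "\<dots> \<longleftrightarrow> card ?inside \<noteq> 0 \<and> card ?outside \<noteq> 0"
      using assms by (simp add: finite_edges_through)
    also have "card ?outside = 2 - card ?inside"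
      using assms card_edges_through_crossing_point[OF that]
      by (simp add: card_Diff_subset finite_edges_through edges_through_mono)
    finally show ?thesis
      by auto
  qed
  ultimately show ?thesis
    by blast
qed

lemma f_val_eq_sum_card_edges_through:
  assumes "edges A \<subseteq> edges G"
  shows "f_val G D A = real (\<Sum>p\<in>crossing_points D G G. card (edges_through D A p)) / 2"
proof -
  let ?C = "crossing_points D G G" and ?incidences = "\<lambda>p. card (edges_through D A p)"
  have "(\<Sum>p\<in>?C. ?incidences p)
      = (\<Sum>p\<in>?C. 2 * of_bool (?incidences p = 2) + of_bool (?incidences p = 1))"
  proof (rule sum.cong[OF refl])
    fix p
    assume "p \<in> ?C"
    then have "?incidences p \<le> 2"
      using assms by (rule card_edges_through_crossing_point_le)
    then show "?incidences p = 2 * of_bool (?incidences p = 2) + of_bool (?incidences p = 1)"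
      by (auto simp: of_bool_def)
  qed
  also have "\<dots> = 2 * card {p \<in> ?C. ?incidences p = 2} + card {p \<in> ?C. ?incidences p = 1}"
    using finite_crossing_points unfolding sum.distrib sum_distrib_left[symmetric]
    by (simp add: Collect_conj_eq)
  also have "\<dots> = 2 * cr_within D A + cr_between D A (delete_edges G (edges A))"
    by (simp only: cr_within_eq_card cr_between_eq_card crossing_points_within[OF assms]
        crossing_points_between[OF assms])
  finally show ?thesis
    by (simp add: f_val_def)
qed

lemma f_val_UN_disjoint:
  assumes "finite I" "disjoint_family_on (\<lambda>i. edges (B i)) I"
    and "edges A = (\<Union>i\<in>I. edges (B i))" and "edges A \<subseteq> edges G"
  shows "f_val G D A = (\<Sum>i\<in>I. f_val G D (B i))"
proof -
  have B_subset: "edges (B i) \<subseteq> edges G" if "i \<in> I" for i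
    using that assms(3,4) by blast
  have "card (edges_through D A p) = (\<Sum>i\<in>I. card (edges_through D (B i) p))" for p
    using assms(1-3) B_subset finite_edges
    by (intro card_edges_through_UN_disjoint) (auto intro: finite_subset)
  then have "f_val G D A
      = real (\<Sum>p\<in>crossing_points D G G. \<Sum>i\<in>I. card (edges_through D (B i) p)) / 2"
    using assms(4) by (simp add: f_val_eq_sum_card_edges_through)
  also have "\<dots> = (\<Sum>i\<in>I. f_val G D (B i))"
    by (subst sum.swap) (simp add: f_val_eq_sum_card_edges_through B_subset sum_divide_distrib)
  finally show ?thesis .
qed

lemma sum_f_val_decomposition:
  assumes "decomposition G t H"
  shows "(\<Sum>k<t. f_val G D (H (Suc k))) = real (cr_within D G)"
  using f_val_UN_disjoint[OF _ decomposition_disjoint_family[OF assms], of G]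
    decomposition_UN_edges[OF assms]
  by (simp add: f_val_whole_graph)

lemma f_val_segment_union:
  assumes "decomposition G t H" "0 < t" "l \<le> t"
  shows "f_val G D (segment_union t H (Suc i) (i + l))
    = (\<Sum>k = i..<i + l. f_val G D (H (Suc (k mod t))))"
proof -
  let ?R = "(\<lambda>k. k mod t) ` {i..<i + l}"
  have "?R \<subseteq> {..<t}"
    using assms(2) by auto
  then have "f_val G D (segment_union t H (Suc i) (i + l)) = (\<Sum>r\<in>?R. f_val G D (H (Suc r)))"
    using disjoint_family_on_mono[OF _ decomposition_disjoint_family[OF assms(1)]]
      decomposition_UN_edges[OF assms(1)]
    by (intro f_val_UN_disjoint) (auto simp: edges_segment_union[OF assms(2)])
  also have "\<dots> = (\<Sum>k = i..<i + l. f_val G D (H (Suc (k mod t))))"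
    by (simp add: sum.reindex inj_on_mod_atLeastLessThan[OF assms(3)])
  finally show ?thesis .
qed

lemma cr_within_ge_iff_l_val_le:
  assumes "decomposition G t H" "0 < t"
  shows "c * real t \<le> real (cr_within D G) \<longleftrightarrow> (\<forall>i\<in>{1..t}. l_val G t H c D i \<le> t)"
proof -
  let ?a = "\<lambda>k. f_val G D (H (Suc k))"
  have l_val_Suc_le_iff: "l_val G t H c D (Suc i) \<le> t \<longleftrightarrow>
      (\<exists>l\<in>{1..t}. real l * c \<le> (\<Sum>k = i..<i + l. ?a (k mod t)))" for i
    using assms by (simp add: l_val_le_iff f_val_segment_union)
  have "(\<forall>i\<in>{1..t}. l_val G t H c D i \<le> t) \<longleftrightarrow> (\<forall>i\<in>Suc ` {..<t}. l_val G t H c D i \<le> t)"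
    by (simp only: image_Suc_lessThan)
  also have "\<dots> \<longleftrightarrow> (\<forall>i<t. l_val G t H c D (Suc i) \<le> t)"
    by blast
  also have "\<dots> \<longleftrightarrow> real t * c \<le> sum ?a {..<t}"
    by (simp only: l_val_Suc_le_iff cyclic_sum_ge_iff_blocks_ge[OF assms(2)])
  also have "sum ?a {..<t} = real (cr_within D G)"
    using sum_f_val_decomposition[OF assms(1)] .
  finally show ?thesis
    by (simp add: mult.commute)
qed

end

theorem theorem1:
  fixes G :: "'v ugraph" and H :: "nat \<Rightarrow> 'v ugraph" and t :: nat
    and c :: real and \<Sigma> :: "'a topology"
  assumes "simple_graph G"
    and "1 \<le> t"
    and "transitive_decomposition G t H"
    and "0 < c"
    and "surface \<Sigma>"
  shows "enat (nat \<lceil>c * real t\<rceil>) \<le> crossing_number \<Sigma> G \<longleftrightarrow>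
    (\<forall>D :: ('v, 'a) drawing. good_drawing \<Sigma> G D \<longrightarrow>
       Max ((\<lambda>i. l_val G t H c D i) ` {1..t}) \<le> t)"
proof -
  have "nat \<lceil>c * real t\<rceil> \<le> cr_within D G \<longleftrightarrow> Max ((\<lambda>i. l_val G t H c D i) ` {1..t}) \<le> t"
    if "good_drawing \<Sigma> G D" for D :: "('v, 'a) drawing"
  proof -
    interpret finite_good_drawing \<Sigma> G D
      using that simple_graph_finite_edges[OF assms(1)] by unfold_locales
    have "nat \<lceil>c * real t\<rceil> \<le> cr_within D G \<longleftrightarrow> c * real t \<le> real (cr_within D G)"
      by (simp add: nat_le_iff ceiling_le_iff)
    also have "\<dots> \<longleftrightarrow> (\<forall>i\<in>{1..t}. l_val G t H c D i \<le> t)"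
      using assms(2,3) by (intro cr_within_ge_iff_l_val_le) (auto simp: transitive_decomposition_def)
    also have "\<dots> \<longleftrightarrow> Max ((\<lambda>i. l_val G t H c D i) ` {1..t}) \<le> t"
      using assms(2) by (subst Max_le_iff) auto
    finally show ?thesis .
  qed
  then show ?thesis
    by (auto simp: crossing_number_def le_INF_iff)
qed

end
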